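(* Let $A_0$ and $A_1$ be r.i. quasi-Banach function spaces (over a common nonatomic $\sigma$-finite measure space $(\mathcal R,\mu)$) that admit, respectively, the representation spaces $\overline A_0$ and $\overline A_1$ over $(0,\infty)$. For $i\in\{0,1\}$ let $\varphi_i(t)=\|\chi_{(0,t)}\|_{\overline A_i}$ for $t\in(0,\infty)$, and set $\sigma=\varphi_0/\varphi_1$. Suppose that $$\left\|\chi_{(0,t)}(s)\,g^*(\tfrac s2)\right\|_{\overline A_0}\lesssim\sigma(t)\,\|g^*\|_{\overline A_1}\quad\text{for all }t\in(0,\infty)\text{ and }g\in A_1,$$ and $$\sigma(t)\left\|\chi_{(t,\infty)}(s)\,h^*(\tfrac s2)\right\|_{\overline A_1}\lesssim\|h^*\|_{\overline A_0}\quad\text{for all }t\in(0,\infty)\text{ and }h\in A_0,$$ with constants in $\lesssim$ independent of $g$, $h$ and $t$ (the norms on the left being taken with respect to the variable $s$). Then $$K(f,\sigma(t);A_0,A_1)\approx\|\chi_{(0,t)}f^*\|_{\overline A_0}+\sigma(t)\,\|\chi_{(t,\infty)}f^*\|_{\overline A_1}$$ for all $f\in A_0+A_1$ and $t\in(0,\infty)$, with constants of equivalence independent of $f$ and $t$.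
   Context: $(\mathcal R,\mu)$ is a nonatomic $\sigma$-finite measure space with $\mu(\mathcal R)\in(0,\infty]$; $\mathcal M$ is the set of $\mu$-measurable functions $\mathcal R\to[-\infty,\infty]$ and $\mathcal M_+$ the subset of those with values in $[0,\infty]$. The non-increasing rearrangement of $f\in\mathcal M$ is $f^*(t)=\inf\{\lambda\ge0:\mu(\{|f|>\lambda\})\le t\}$. A quasi-Banach function norm is a map $\|\cdot\|\colon\mathcal M\to[0,\infty]$ with $\|\,|f|\,\|=\|f\|$ whose restriction to $\mathcal M_+$ satisfies: positive homogeneity; $\|f\|=0\iff f=0$ a.e.; $\|f+g\|\le C(\|f\|+\|g\|)$ for some constant $C$; the lattice property ($f\le g$ a.e. implies $\|f\|\le\|g\|$); the Fatou property ($f_n\uparrow f$ a.e. implies $\|f_n\|\uparrow\|f\|$); and $\|\chi_E\|<\infty$ whenever $\mu(E)<\infty$. It is rearrangement-invariant (r.i.) if $\|f\|=\|g\|$ whenever $f^*=g^*$. The corresponding r.i. quasi-Banach function space is $X=\{f\in\mathcal M:\|f\|_X<\infty\}$. A representation space $\overline X$ of $X$ is given by an r.i. quasi-Banach function norm $\|\cdot\|_{\overline X}$ on measurable functions on $(0,\infty)$ with Lebesgue measure such that $\|f\|_X=\|f^*\|_{\overline X}$ for all $f\in\mathcal M$. $A_0+A_1$ is the set of $f\in\mathcal M$ that can be written as $f=f_0+f_1$ with $f_i\in A_i$, and $K(f,t;A_0,A_1)=\inf\{\|f_0\|_{A_0}+t\|f_1\|_{A_1}: f=f_0+f_1,\ f_i\in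 A_i\}$. $\lesssim$ means $\le$ up to a positive multiplicative constant; $\approx$ means $\lesssim$ in both directions. *)

theory Defs
  imports "HOL-Analysis.Analysis"
begin

definition nonatomic :: "'a measure \<Rightarrow> bool" where
  "nonatomic M \<longleftrightarrow>
     (\<forall>A\<in>sets M. 0 < emeasure M A \<longrightarrow>
        (\<exists>B\<in>sets M. B \<subseteq> A \<and> 0 < emeasure M B \<and> emeasure M B < emeasure M A))"

text \<open>The measurable functions into the extended real line are \<open>borel_measurable M\<close> at
  type \<open>ereal\<close>; the values outside \<open>space M\<close> play no role.\<close>

definition nonneg_measurable :: "'a measure \<Rightarrow> ('a \<Rightarrow> ereal) set" where
  "nonneg_measurable M = {f \<in> borel_measurable M. \<forall>x\<in>space M. 0 \<le> f x}"

text \<open>The infimum is taken in \<open>ereal\<close>, so it is \<open>\<infinity>\<close> if no finite level \<open>l\<close> qualifies.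
  Only the values at \<open>t > 0\<close> are ever used.\<close>

definition rearrangement :: "'a measure \<Rightarrow> ('a \<Rightarrow> ereal) \<Rightarrow> real \<Rightarrow> ereal" where
  "rearrangement M f t =
     (INF l\<in>{l::real. 0 \<le> l \<and> emeasure M {x \<in> space M. ereal l < \<bar>f x\<bar>} \<le> ennreal t}. ereal l)"

definition quasi_banach_function_norm :: "'a measure \<Rightarrow> (('a \<Rightarrow> ereal) \<Rightarrow> ennreal) \<Rightarrow> bool" where
  "quasi_banach_function_norm M N \<longleftrightarrow>
     (\<forall>f\<in>borel_measurable M. N (\<lambda>x. \<bar>f x\<bar>) = N f) \<and>
     (\<forall>f\<in>nonneg_measurable M. \<forall>a::real. 0 \<le> a \<longrightarrow> N (\<lambda>x. ereal a * f x) = ennreal a * N f) \<and>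
     (\<forall>f\<in>nonneg_measurable M. N f = 0 \<longleftrightarrow> (AE x in M. f x = 0)) \<and>
     (\<exists>C::real. 0 < C \<and> (\<forall>f\<in>nonneg_measurable M. \<forall>g\<in>nonneg_measurable M.
        N (\<lambda>x. f x + g x) \<le> ennreal C * (N f + N g))) \<and>
     (\<forall>f\<in>nonneg_measurable M. \<forall>g\<in>nonneg_measurable M.
        (AE x in M. f x \<le> g x) \<longrightarrow> N f \<le> N g) \<and>
     (\<forall>F f. (\<forall>n::nat. F n \<in> nonneg_measurable M) \<longrightarrow> f \<in> nonneg_measurable M \<longrightarrow>
        (AE x in M. incseq (\<lambda>n. F n x) \<and> (\<lambda>n. F n x) \<longlonglongrightarrow> f x) \<longrightarrow>
        incseq (\<lambda>n. N (F n)) \<and> (\<lambda>n. N (F n)) \<longlonglongrightarrow> N f) \<and>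
     (\<forall>E\<in>sets M. emeasure M E < \<infinity> \<longrightarrow> N (indicator E) < \<infinity>)"

definition ri_quasi_banach_function_norm :: "'a measure \<Rightarrow> (('a \<Rightarrow> ereal) \<Rightarrow> ennreal) \<Rightarrow> bool" where
  "ri_quasi_banach_function_norm M N \<longleftrightarrow>
     quasi_banach_function_norm M N \<and>
     (\<forall>f\<in>borel_measurable M. \<forall>g\<in>borel_measurable M.
        (\<forall>t>0. rearrangement M f t = rearrangement M g t) \<longrightarrow> N f = N g)"

text \<open>A function space is represented by its norm \<open>N\<close>.\<close>

definition function_space :: "'a measure \<Rightarrow> (('a \<Rightarrow> ereal) \<Rightarrow> ennreal) \<Rightarrow> ('a \<Rightarrow> ereal) set" where
  "function_space M N = {f \<in> borel_measurable M. N f < \<infinity>}"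

definition representation_norm ::
  "'a measure \<Rightarrow> (('a \<Rightarrow> ereal) \<Rightarrow> ennreal) \<Rightarrow> ((real \<Rightarrow> ereal) \<Rightarrow> ennreal) \<Rightarrow> bool" where
  "representation_norm M N R \<longleftrightarrow>
     ri_quasi_banach_function_norm (lebesgue_on {0<..}) R \<and>
     (\<forall>f\<in>borel_measurable M. N f = R (rearrangement M f))"

text \<open>Decompositions are understood almost everywhere. Members of a quasi-Banach function space
  are finite almost everywhere, so the undefined sums \<open>\<infinity> + (-\<infinity>)\<close> occur only on null sets.\<close>

definition decompositions ::
  "'a measure \<Rightarrow> (('a \<Rightarrow> ereal) \<Rightarrow> ennreal) \<Rightarrow> (('a \<Rightarrow> ereal) \<Rightarrow> ennreal) \<Rightarrow> ('a \<Rightarrow> ereal)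
     \<Rightarrow> (('a \<Rightarrow> ereal) \<times> ('a \<Rightarrow> ereal)) set" where
  "decompositions M N0 N1 f =
     {(f0, f1). f0 \<in> function_space M N0 \<and> f1 \<in> function_space M N1 \<and>
                (AE x in M. f x = f0 x + f1 x)}"

definition sum_space ::
  "'a measure \<Rightarrow> (('a \<Rightarrow> ereal) \<Rightarrow> ennreal) \<Rightarrow> (('a \<Rightarrow> ereal) \<Rightarrow> ennreal) \<Rightarrow> ('a \<Rightarrow> ereal) set" where
  "sum_space M N0 N1 = {f \<in> borel_measurable M. decompositions M N0 N1 f \<noteq> {}}"

definition K_functional ::
  "'a measure \<Rightarrow> (('a \<Rightarrow> ereal) \<Rightarrow> ennreal) \<Rightarrow> (('a \<Rightarrow> ereal) \<Rightarrow> ennreal) \<Rightarrow> ('a \<Rightarrow> ereal)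
     \<Rightarrow> ennreal \<Rightarrow> ennreal" where
  "K_functional M N0 N1 f t = (INF (f0, f1)\<in>decompositions M N0 N1 f. N0 f0 + t * N1 f1)"

definition fundamental_function :: "((real \<Rightarrow> ereal) \<Rightarrow> ennreal) \<Rightarrow> real \<Rightarrow> ennreal" where
  "fundamental_function R t = R (indicator {0<..<t})"

end

theory Submission imports Defs begin

text \<open>For the upper bound, cut \<open>f\<close> at the level \<open>a = f\<^sup>*(t)\<close>: the part above the level has rearrangement
  at most \<open>\<chi>\<^bsub>(0,t)\<^esub> f\<^sup>*\<close>, the truncation has rearrangement at most
  \<open>a \<chi>\<^bsub>(0,t)\<^esub> + \<chi>\<^bsub>(t,\<infinity>)\<^esub> f\<^sup>*\<close> almost everywhere, and \<open>\<sigma>(t) a \<phi>\<^sub>1(t) = a \<phi>\<^sub>0(t)\<close> is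
  absorbed by the norm of \<open>\<chi>\<^bsub>(0,t)\<^esub> f\<^sup>*\<close>. For the lower bound, a decomposition \<open>f = f\<^sub>0 + f\<^sub>1\<close> gives
  \<open>f\<^sup>*(s) \<le> f\<^sub>0\<^sup>*(s/2) + f\<^sub>1\<^sup>*(s/2)\<close>; of the four resulting terms the two hypotheses control the
  mixed ones, and the boundedness of the dilation \<open>g \<mapsto> g(\<cdot>/2)\<close> on r.i. spaces the other two.\<close>

section \<open>The non-increasing rearrangement\<close>

lemma rearrangement_nonneg: "0 \<le> rearrangement M f t"
  unfolding rearrangement_def by (rule INF_greatest) auto

lemma rearrangement_antimono: "s \<le> t \<Longrightarrow> rearrangement M f t \<le> rearrangement M f s"
  unfolding rearrangement_def
  by (rule INF_superset_mono) (auto intro: order_trans ennreal_leI)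

text \<open>Superlevel sets of a non-increasing function are intervals, hence Borel.\<close>

lemma borel_measurable_rearrangement [measurable]: "rearrangement M f \<in> borel_measurable borel"
proof (rule borel_measurableI_greater)
  fix y
  have "is_interval {x. y < rearrangement M f x}"
    unfolding is_interval_1 by (auto intro: less_le_trans rearrangement_antimono)
  then show "{x \<in> space borel. y < rearrangement M f x} \<in> sets borel"
    using real_interval_borel_measurable by simp
qed

lemma rearrangement_cong_distribution:
  assumes "\<And>l. 0 \<le> l \<Longrightarrow> emeasure M {x \<in> space M. ereal l < \<bar>f x\<bar>}
                       = emeasure N {x \<in> space N. ereal l < \<bar>g x\<bar>}"
  shows "rearrangement M f = rearrangement N g"
proof (rule ext)
  fix t
  have "{l. 0 \<le> l \<and> emeasure M {x \<in> space M. ereal l < \<bar>f x\<bar>} \<le> ennreal t}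
      = {l. 0 \<le> l \<and> emeasure N {x \<in> space N. ereal l < \<bar>g x\<bar>} \<le> ennreal t}"
    using assms by auto
  then show "rearrangement M f t = rearrangement N g t"
    unfolding rearrangement_def by simp
qed

lemma rearrangement_le:
  assumes "0 \<le> l" "emeasure M {x \<in> space M. ereal l < \<bar>f x\<bar>} \<le> ennreal t"
  shows "rearrangement M f t \<le> ereal l"
  unfolding rearrangement_def using assms by (intro INF_lower) auto

lemma rearrangement_mono:
  assumes [measurable]: "g \<in> borel_measurable M"
    and le: "\<And>x. x \<in> space M \<Longrightarrow> \<bar>f x\<bar> \<le> \<bar>g x\<bar>"
  shows "rearrangement M f t \<le> rearrangement M g t"
  unfolding rearrangement_def
proof (rule INF_superset_mono)
  show "{l. 0 \<le> l \<and> emeasure M {x \<in> space M. ereal l < \<bar>g x\<bar>} \<le> ennreal t}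
      \<subseteq> {l. 0 \<le> l \<and> emeasure M {x \<in> space M. ereal l < \<bar>f x\<bar>} \<le> ennreal t}"
  proof clarify
    fix l assume l: "emeasure M {x \<in> space M. ereal l < \<bar>g x\<bar>} \<le> ennreal t"
    have "emeasure M {x \<in> space M. ereal l < \<bar>f x\<bar>} \<le> emeasure M {x \<in> space M. ereal l < \<bar>g x\<bar>}"
      using le by (intro emeasure_mono) (auto intro: less_le_trans)
    with l show "emeasure M {x \<in> space M. ereal l < \<bar>f x\<bar>} \<le> ennreal t" by simp
  qed
qed simp

lemma rearrangement_less_obtain:
  assumes "rearrangement M f t < y"
  obtains l where "0 \<le> l" "ereal l < y" "emeasure M {x \<in> space M. ereal l < \<bar>f x\<bar>} \<le> ennreal t"
  using assms unfolding rearrangement_def INF_less_iff by auto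

text \<open>The infimum defining the rearrangement is attained when finite: the sets {|f| > a +
  1/(n+1)} increase to {|f| > a}, so their common bound \<open>t\<close> passes to the limit by
  continuity from below.\<close>

lemma emeasure_above_rearrangement:
  assumes [measurable]: "f \<in> borel_measurable M" and a: "rearrangement M f t = ereal a"
  shows "emeasure M {x \<in> space M. ereal a < \<bar>f x\<bar>} \<le> ennreal t"
proof -
  define E where "E n = {x \<in> space M. ereal (a + inverse (real (Suc n))) < \<bar>f x\<bar>}" for n
  have meas: "range E \<subseteq> sets M" unfolding E_def by auto
  have inc: "incseq E"
  proof (rule incseq_SucI, rule subsetI)
    fix n x assume x: "x \<in> E n"
    have "ereal (a + inverse (real (Suc (Suc n)))) \<le> ereal (a + inverse (real (Suc n)))"
      by (simp add: field_simps)
    with x show "x \<in> E (Suc n)" unfolding E_def using le_less_trans by blast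
  qed
  have bound: "emeasure M (E n) \<le> ennreal t" for n
  proof -
    have "rearrangement M f t < ereal (a + inverse (real (Suc n)))" by (simp add: a)
    then obtain l where l: "ereal l < ereal (a + inverse (real (Suc n)))"
      "emeasure M {x \<in> space M. ereal l < \<bar>f x\<bar>} \<le> ennreal t"
      by (rule rearrangement_less_obtain)
    have "E n \<subseteq> {x \<in> space M. ereal l < \<bar>f x\<bar>}"
      unfolding E_def using less_trans[OF l(1)] by blast
    then have "emeasure M (E n) \<le> emeasure M {x \<in> space M. ereal l < \<bar>f x\<bar>}"
      by (intro emeasure_mono) auto
    with l(2) show ?thesis by simp
  qed
  have "{x \<in> space M. ereal a < \<bar>f x\<bar>} = (\<Union>n. E n)"
  proof (intro set_eqI iffI)
    fix x assume x: "x \<in> {x \<in> space M. ereal a < \<bar>f x\<bar>}"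
    \<comment> \<open>Since |f x| may be infinite, a real \<open>b\<close> is placed strictly in
      between, and the Archimedean property is applied to the real gap b - a.\<close>
    then obtain b where b: "ereal a < ereal b" "ereal b < \<bar>f x\<bar>" using ereal_dense2 by blast
    then obtain n where "inverse (real (Suc n)) < b - a"
      using reals_Archimedean[of "b - a"] by auto
    then have "ereal (a + inverse (real (Suc n))) \<le> ereal b" by simp
    then have "ereal (a + inverse (real (Suc n))) < \<bar>f x\<bar>" using b(2) by (rule le_less_trans)
    then have "x \<in> E n" unfolding E_def using x by blast
    then show "x \<in> (\<Union>n. E n)" by auto
  next
    fix x assume "x \<in> (\<Union>n. E n)"
    then obtain n where "x \<in> space M" and n: "ereal (a + inverse (real (Suc n))) < \<bar>f x\<bar>"
      unfolding E_def by auto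
    moreover have "ereal a \<le> ereal (a + inverse (real (Suc n)))" by simp
    ultimately show "x \<in> {x \<in> space M. ereal a < \<bar>f x\<bar>}" using le_less_trans by blast
  qed
  then have "emeasure M {x \<in> space M. ereal a < \<bar>f x\<bar>} = (SUP n. emeasure M (E n))"
    using SUP_emeasure_incseq[OF meas inc] by simp
  also have "\<dots> \<le> ennreal t" by (rule SUP_least) (rule bound)
  finally show ?thesis .
qed

lemma rearrangement_add_le:
  assumes [measurable]: "f \<in> borel_measurable M" "g \<in> borel_measurable M" "h \<in> borel_measurable M"
    and sum: "AE x in M. f x = g x + h x" and t: "0 < t"
  shows "rearrangement M f t \<le> rearrangement M g (t / 2) + rearrangement M h (t / 2)"
proof (cases "rearrangement M g (t / 2) = \<infinity> \<or> rearrangement M h (t / 2) = \<infinity>")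
  case True
  then show ?thesis
    using rearrangement_nonneg[of M g "t / 2"] rearrangement_nonneg[of M h "t / 2"] by auto
next
  case False
  obtain a where a: "rearrangement M g (t / 2) = ereal a"
    using False rearrangement_nonneg[of M g "t / 2"] by (cases "rearrangement M g (t / 2)") auto
  obtain b where b: "rearrangement M h (t / 2) = ereal b"
    using False rearrangement_nonneg[of M h "t / 2"] by (cases "rearrangement M h (t / 2)") auto
  have "0 \<le> a" "0 \<le> b"
    using rearrangement_nonneg[of M g "t / 2"] rearrangement_nonneg[of M h "t / 2"] a b by auto
  let ?G = "{x \<in> space M. ereal a < \<bar>g x\<bar>}" and ?H = "{x \<in> space M. ereal b < \<bar>h x\<bar>}"
  have "emeasure M {x \<in> space M. ereal (a + b) < \<bar>f x\<bar>} \<le> emeasure M (?G \<union> ?H)"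
  proof (rule emeasure_mono_AE)
    show "AE x in M. x \<in> {x \<in> space M. ereal (a + b) < \<bar>f x\<bar>} \<longrightarrow> x \<in> ?G \<union> ?H"
      using sum
    proof eventually_elim
      case (elim x)
      \<comment> \<open>This survives the undefined sum \<infinity> + (-\<infinity>), because the
        right-hand side is then infinite.\<close>
      have "\<bar>f x\<bar> \<le> \<bar>g x\<bar> + \<bar>h x\<bar>" unfolding elim by (cases "g x"; cases "h x") auto
      then have "\<not> ereal (a + b) < \<bar>f x\<bar>" if "\<bar>g x\<bar> \<le> ereal a" "\<bar>h x\<bar> \<le> ereal b"
        using add_mono[OF that] by (auto simp: not_less)
      then show ?case by (cases "ereal a < \<bar>g x\<bar>"; cases "ereal b < \<bar>h x\<bar>") (auto simp: not_less)
    qed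
  qed measurable
  also have "\<dots> \<le> emeasure M ?G + emeasure M ?H" by (rule emeasure_subadditive) auto
  also have "\<dots> \<le> ennreal (t / 2) + ennreal (t / 2)"
    using emeasure_above_rearrangement[OF _ a] emeasure_above_rearrangement[OF _ b]
    by (intro add_mono) auto
  also have "\<dots> = ennreal t" using t by (simp flip: ennreal_plus)
  finally show ?thesis
    unfolding a b using \<open>0 \<le> a\<close> \<open>0 \<le> b\<close> by (simp add: rearrangement_le)
qed

section \<open>Dilations\<close>

lemma emeasure_lborel_vimage_minus:
  fixes c :: real
  assumes "S \<in> sets borel"
  shows "emeasure lborel {x. x - c \<in> S} = emeasure lborel S"
proof -
  have "emeasure lborel S = emeasure (distr lborel borel ((+) (- c))) S"
    by (simp add: lborel_distr_plus)
  also have "\<dots> = emeasure lborel {x. x - c \<in> S}"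
    using assms by (subst emeasure_distr) (auto simp: vimage_def)
  finally show ?thesis ..
qed

lemma emeasure_lborel_vimage_half:
  fixes S :: "real set"
  assumes "S \<in> sets borel"
  shows "emeasure lborel {x. x / 2 \<in> S} = 2 * emeasure lborel S"
proof -
  have [measurable]: "S \<in> sets lborel" using assms by simp
  have "emeasure lborel {x. x / 2 \<in> S} = emeasure (distr lborel borel ((*) (1 / 2))) S"
    using assms by (subst emeasure_distr) (auto simp: vimage_def)
  \<comment> \<open>The image of Lebesgue measure under multiplication by c has constant density
    1/|c|; here c = 1/2.\<close>
  also have "\<dots> = emeasure (density lborel (\<lambda>_. ennreal 2)) S"
    by (subst lborel_distr_mult) auto
  also have "\<dots> = 2 * emeasure lborel S"
    using assms by (subst emeasure_density_const) auto
  finally show ?thesis .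
qed

section \<open>Folding the half-line onto itself twice\<close>

text \<open>For \<open>i \<in> {0, 1}\<close> this maps the union of the intervals \<open>[2k + i, 2k + i + 1)\<close>, \<open>k \<ge> 0\<close>,
  onto \<open>[0, \<infinity>)\<close> by translating the pieces, so that \<open>(0, \<infinity>)\<close> is covered twice.\<close>

definition fold_map :: "real \<Rightarrow> real" where
  "fold_map s = s - real_of_int ((\<lfloor>s\<rfloor> + 1) div 2)"

lemma measurable_fold_map [measurable]: "fold_map \<in> borel_measurable borel"
proof -
  \<comment> \<open>Integer division is rewritten as the floor of a real quotient, which the
    measurability rules can handle.\<close>
  have *: "fold_map = (\<lambda>s. s - real_of_int \<lfloor>(real_of_int \<lfloor>s\<rfloor> + 1) / 2\<rfloor>)"
  proof
    fix s :: real
    have "\<lfloor>(real_of_int \<lfloor>s\<rfloor> + 1) / 2\<rfloor> = (\<lfloor>s\<rfloor> + 1) div 2"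
      using floor_divide_of_int_eq[of "\<lfloor>s\<rfloor> + 1" 2, where ?'a = real] by simp
    then show "fold_map s = s - real_of_int \<lfloor>(real_of_int \<lfloor>s\<rfloor> + 1) / 2\<rfloor>"
      unfolding fold_map_def by simp
  qed
  show ?thesis unfolding * by measurable
qed

text \<open>Cut \<open>S\<close> into the pieces in [k, k+1). The part of the preimage with floor of
  parity \<open>i\<close> consists of these pieces translated by k + i into [2k+i, 2k+i+1). The
  translates are disjoint, so translation invariance and countable additivity give the
  measure.\<close>

lemma emeasure_fold_map:
  assumes S [measurable]: "S \<in> sets borel" and "S \<subseteq> {0<..}" and i: "i = 0 \<or> i = (1::int)"
  shows "emeasure lborel {s. 0 < s \<and> \<lfloor>s\<rfloor> mod 2 = i \<and> fold_map s \<in> S} = emeasure lborel S"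
proof -
  let ?P = "\<lambda>k::nat. S \<inter> {real k..<real k + 1}"
  let ?Q = "\<lambda>k::nat. {s. s - real_of_int (int k + i) \<in> ?P k}"
  have floor_P: "\<lfloor>x\<rfloor> = int k" if "x \<in> ?P k" for x k
    using that by (auto simp: floor_eq_iff)
  have floor_Q: "\<lfloor>s\<rfloor> = 2 * int k + i" if "s \<in> ?Q k" for s k
    using that by (auto simp: floor_eq_iff)
  have T: "{s. 0 < s \<and> \<lfloor>s\<rfloor> mod 2 = i \<and> fold_map s \<in> S} = (\<Union>k. ?Q k)"
  proof (intro set_eqI iffI)
    fix s assume s: "s \<in> {s. 0 < s \<and> \<lfloor>s\<rfloor> mod 2 = i \<and> fold_map s \<in> S}"
    define k where "k = nat (\<lfloor>s\<rfloor> div 2)"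
    have "0 \<le> \<lfloor>s\<rfloor>" using s by simp
    then have k: "\<lfloor>s\<rfloor> = 2 * int k + i" unfolding k_def using s by auto
    then have "(\<lfloor>s\<rfloor> + 1) div 2 = int k + i" using i by auto
    then have "s - real_of_int (int k + i) \<in> S" using s unfolding fold_map_def by simp
    moreover have "2 * real k + real_of_int i \<le> s" "s < 2 * real k + real_of_int i + 1"
      using k by (simp_all add: floor_eq_iff)
    ultimately have "s \<in> ?Q k" by auto
    then show "s \<in> (\<Union>k. ?Q k)" by blast
  next
    fix s assume "s \<in> (\<Union>k. ?Q k)"
    then obtain k where k: "s \<in> ?Q k" by blast
    have fl: "\<lfloor>s\<rfloor> = 2 * int k + i" by (rule floor_Q[OF k])
    then have "(\<lfloor>s\<rfloor> + 1) div 2 = int k + i" "\<lfloor>s\<rfloor> mod 2 = i" using i by auto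
    \<comment> \<open>For k = i = 0 this rests on \<open>S\<close> avoiding 0; in all other cases s
      is at least 1.\<close>
    moreover have "0 < s" using k i \<open>S \<subseteq> {0<..}\<close> by force
    ultimately show "s \<in> {s. 0 < s \<and> \<lfloor>s\<rfloor> mod 2 = i \<and> fold_map s \<in> S}"
      using k unfolding fold_map_def by auto
  qed
  have US: "S = (\<Union>k. ?P k)"
  proof (intro set_eqI iffI)
    fix x assume x: "x \<in> S"
    then have "0 < x" using \<open>S \<subseteq> {0<..}\<close> by auto
    then have "x \<in> ?P (nat \<lfloor>x\<rfloor>)" using x by auto
    then show "x \<in> (\<Union>k. ?P k)" by blast
  qed auto
  have "disjoint_family ?P"
    using floor_P unfolding disjoint_family_on_def by (metis disjoint_iff of_nat_eq_iff)
  have "disjoint_family ?Q"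
    unfolding disjoint_family_on_def
  proof (intro ballI impI)
    fix m n :: nat assume "m \<noteq> n"
    then show "?Q m \<inter> ?Q n = {}" using floor_Q[of _ m] floor_Q[of _ n] by fastforce
  qed
  have "emeasure lborel (\<Union>k. ?Q k) = (\<Sum>k. emeasure lborel (?Q k))"
    using \<open>disjoint_family ?Q\<close> by (intro suminf_emeasure[symmetric]) auto
  also have "\<dots> = (\<Sum>k. emeasure lborel (?P k))"
    by (intro suminf_cong emeasure_lborel_vimage_minus) auto
  also have "\<dots> = emeasure lborel (\<Union>k. ?P k)"
    using \<open>disjoint_family ?P\<close> by (intro suminf_emeasure) auto
  finally show ?thesis unfolding T using US by simp
qed

section \<open>From Lebesgue measure on the line to the half-line\<close>

lemma emeasure_lebesgue_on_pos:
  fixes S :: "real set"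
  assumes "S \<in> sets borel" "S \<subseteq> {0<..}"
  shows "emeasure (lebesgue_on {0<..}) S = emeasure lborel S"
  using assms by (subst emeasure_restrict_space) auto

text \<open>Reduces equimeasurability on the half-line to distribution functions under
  \<open>lborel\<close>, where the translation and scaling results above apply.\<close>

lemma rearrangement_lebesgue_on_eqI:
  fixes g h :: "real \<Rightarrow> ereal"
  assumes [measurable]: "g \<in> borel_measurable borel" "h \<in> borel_measurable borel"
    and "\<And>l. 0 \<le> l \<Longrightarrow> emeasure lborel {s. 0 < s \<and> ereal l < \<bar>g s\<bar>}
      = emeasure lborel {s. 0 < s \<and> ereal l < \<bar>h s\<bar>}"
  shows "rearrangement (lebesgue_on {0<..}) g = rearrangement (lebesgue_on {0<..}) h"
proof (rule rearrangement_cong_distribution)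
  fix l :: real assume "0 \<le> l"
  have "emeasure (lebesgue_on {0<..}) {s. 0 < s \<and> ereal l < \<bar>f s\<bar>}
      = emeasure lborel {s. 0 < s \<and> ereal l < \<bar>f s\<bar>}"
    if [measurable]: "f \<in> borel_measurable borel" for f :: "real \<Rightarrow> ereal"
    by (rule emeasure_lebesgue_on_pos) auto
  then show "emeasure (lebesgue_on {0<..}) {x \<in> space (lebesgue_on {0<..}). ereal l < \<bar>g x\<bar>}
     = emeasure (lebesgue_on {0<..}) {x \<in> space (lebesgue_on {0<..}). ereal l < \<bar>h x\<bar>}"
    using assms \<open>0 \<le> l\<close> by simp
qed

lemma nonneg_measurable_lebesgue_on:
  fixes g :: "real \<Rightarrow> ereal"
  assumes "g \<in> borel_measurable borel" "\<And>s. 0 < s \<Longrightarrow> 0 \<le> g s"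
  shows "g \<in> nonneg_measurable (lebesgue_on {0<..})"
  using assms unfolding nonneg_measurable_def
  by (auto intro!: measurable_restrict_space1 measurable_completion)

section \<open>Quasi-Banach function norms\<close>

lemma quasi_norm_mult:
  assumes "quasi_banach_function_norm M N" "f \<in> nonneg_measurable M" "0 \<le> a"
  shows "N (\<lambda>x. ereal a * f x) = ennreal a * N f"
  using quasi_banach_function_norm_def[THEN iffD1, OF assms(1), THEN conjunct2, THEN conjunct1]
    assms(2,3) by simp

lemma quasi_norm_eq_0_iff:
  assumes "quasi_banach_function_norm M N" "f \<in> nonneg_measurable M"
  shows "N f = 0 \<longleftrightarrow> (AE x in M. f x = 0)"
  using quasi_banach_function_norm_def[THEN iffD1, OF assms(1),
      THEN conjunct2, THEN conjunct2, THEN conjunct1]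
    assms(2) by simp

text \<open>The norm axioms only assert that some constant exists; naming it allows the final
  constants to be written in terms of it.\<close>

definition quasi_triangle :: "'a measure \<Rightarrow> (('a \<Rightarrow> ereal) \<Rightarrow> ennreal) \<Rightarrow> real \<Rightarrow> bool" where
  "quasi_triangle M N C \<longleftrightarrow> 0 < C \<and> (\<forall>f\<in>nonneg_measurable M. \<forall>g\<in>nonneg_measurable M.
     N (\<lambda>x. f x + g x) \<le> ennreal C * (N f + N g))"

lemma quasi_triangle_pos: "quasi_triangle M N C \<Longrightarrow> 0 < C"
  unfolding quasi_triangle_def by (rule conjunct1)

lemma quasi_triangleD:
  assumes "quasi_triangle M N C" "f \<in> nonneg_measurable M" "g \<in> nonneg_measurable M"
  shows "N (\<lambda>x. f x + g x) \<le> ennreal C * (N f + N g)"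
  using assms(1)[unfolded quasi_triangle_def, THEN conjunct2] assms(2,3) by blast

lemma quasi_norm_triangle:
  assumes "quasi_banach_function_norm M N"
  obtains C where "quasi_triangle M N C"
  unfolding quasi_triangle_def
  using quasi_banach_function_norm_def[THEN iffD1, OF assms,
      THEN conjunct2, THEN conjunct2, THEN conjunct2, THEN conjunct1]
  by blast

lemma quasi_norm_mono:
  assumes "quasi_banach_function_norm M N" "f \<in> nonneg_measurable M" "g \<in> nonneg_measurable M"
    "AE x in M. f x \<le> g x"
  shows "N f \<le> N g"
  using quasi_banach_function_norm_def[THEN iffD1, OF assms(1),
      THEN conjunct2, THEN conjunct2, THEN conjunct2, THEN conjunct2, THEN conjunct1]
    assms(2-4) by simp

lemma quasi_norm_indicator_finite:
  assumes "quasi_banach_function_norm M N" "E \<in> sets M" "emeasure M E < \<infinity>"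
  shows "N (indicator E) < \<infinity>"
  using quasi_banach_function_norm_def[THEN iffD1, OF assms(1),
      THEN conjunct2, THEN conjunct2, THEN conjunct2, THEN conjunct2, THEN conjunct2, THEN conjunct2]
    assms(2,3) by simp

lemma ri_quasi_norm: "ri_quasi_banach_function_norm M N \<Longrightarrow> quasi_banach_function_norm M N"
  unfolding ri_quasi_banach_function_norm_def by (rule conjunct1)

lemma ri_quasi_norm_eq:
  assumes "ri_quasi_banach_function_norm M N" "f \<in> borel_measurable M" "g \<in> borel_measurable M"
    "\<And>t. 0 < t \<Longrightarrow> rearrangement M f t = rearrangement M g t"
  shows "N f = N g"
  using assms(1)[unfolded ri_quasi_banach_function_norm_def, THEN conjunct2] assms(2-4) by blast

lemma representation_norm_ri:
  "representation_norm M N R \<Longrightarrow> ri_quasi_banach_function_norm (lebesgue_on {0<..}) R"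
  unfolding representation_norm_def by (rule conjunct1)

lemma representation_norm_eq:
  "representation_norm M N R \<Longrightarrow> f \<in> borel_measurable M \<Longrightarrow> N f = R (rearrangement M f)"
  unfolding representation_norm_def by (drule conjunct2) (erule bspec)

text \<open>A copy of the dilated function is the sum of two disjointly supported copies of the
  function itself.\<close>

lemma dilation_bounded:
  fixes R :: "(real \<Rightarrow> ereal) \<Rightarrow> ennreal" and g :: "real \<Rightarrow> ereal"
  assumes ri: "ri_quasi_banach_function_norm (lebesgue_on {0<..}) R"
    and g [measurable]: "g \<in> borel_measurable borel" and nonneg: "\<And>s. 0 \<le> g s"
    and tri: "quasi_triangle (lebesgue_on {0<..}) R C"
  shows "R (\<lambda>s. g (s / 2)) \<le> ennreal C * (R g + R g)"
proof -
  \<comment> \<open>By rearrangement invariance, \<open>R\<close> sees only the distribution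
    function of a Borel function on the half-line.\<close>
  have R_eqI: "R h = R k" if [measurable]: "h \<in> borel_measurable borel" "k \<in> borel_measurable borel"
    and "\<And>l. 0 \<le> l \<Longrightarrow> emeasure lborel {s. 0 < s \<and> ereal l < \<bar>h s\<bar>}
      = emeasure lborel {s. 0 < s \<and> ereal l < \<bar>k s\<bar>}"
  for h k :: "real \<Rightarrow> ereal"
  proof -
    have "h \<in> borel_measurable (lebesgue_on {0<..})" "k \<in> borel_measurable (lebesgue_on {0<..})"
      by (auto intro!: measurable_restrict_space1 measurable_completion)
    then show ?thesis
      by (rule ri_quasi_norm_eq[OF ri]) (simp only: rearrangement_lebesgue_on_eqI[OF that])
  qed
  \<comment> \<open>\<open>h i\<close> is the copy of \<open>g\<close> living on the unit intervals
    of parity \<open>i\<close>. For s > 0 the guard \<open>0 < fold_map s\<close> fails only at s =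
    1, which folds to 0, outside the half-line.\<close>
  define h where "h i s = (if \<lfloor>s\<rfloor> mod 2 = i \<and> 0 < fold_map s then g (fold_map s) else 0)"
    for i :: int and s :: real
  have [measurable]: "h i \<in> borel_measurable borel" for i unfolding h_def by measurable
  have h_nonneg: "0 \<le> h i s" for i s unfolding h_def using nonneg by simp
  define S where "S l = {s. 0 < s \<and> ereal l < \<bar>g s\<bar>}" for l
  have [measurable]: "S l \<in> sets borel" for l unfolding S_def by measurable
  let ?T = "\<lambda>i l. {s. 0 < s \<and> \<lfloor>s\<rfloor> mod 2 = i \<and> fold_map s \<in> S l}"
  have Rh: "R (h i) = R g" if i: "i = 0 \<or> i = 1" for i
  proof (rule R_eqI)
    fix l :: real assume "0 \<le> l"
    then have "{s. 0 < s \<and> ereal l < \<bar>h i s\<bar>} = ?T i l"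
      unfolding h_def S_def by auto
    then show "emeasure lborel {s. 0 < s \<and> ereal l < \<bar>h i s\<bar>}
      = emeasure lborel {s. 0 < s \<and> ereal l < \<bar>g s\<bar>}"
      using emeasure_fold_map[of "S l" i] i unfolding S_def by auto
  qed auto
  \<comment> \<open>Both functions have distribution function twice the measure of
    \<open>S l\<close>: the dilation by scaling, the sum because each of the two disjoint copies
    contributes once.\<close>
  have "R (\<lambda>s. g (s / 2)) = R (\<lambda>s. h 0 s + h 1 s)"
  proof (rule R_eqI)
    fix l :: real assume "0 \<le> l"
    have sum: "h 0 s + h 1 s = (if 0 < fold_map s then g (fold_map s) else 0)" for s
      unfolding h_def by auto
    have sets: "?T i l \<in> sets lborel" for i by measurable
    have "{s. 0 < s \<and> ereal l < \<bar>g (s / 2)\<bar>} = {s. s / 2 \<in> S l}" unfolding S_def by auto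
    then have "emeasure lborel {s. 0 < s \<and> ereal l < \<bar>g (s / 2)\<bar>} = 2 * emeasure lborel (S l)"
      by (simp add: emeasure_lborel_vimage_half)
    also have "\<dots> = emeasure lborel (?T 0 l) + emeasure lborel (?T 1 l)"
      by (subst (1 2) emeasure_fold_map) (auto simp: S_def mult_2)
    also have "\<dots> = emeasure lborel (?T 0 l \<union> ?T 1 l)"
      using sets by (intro plus_emeasure) auto
    also have "?T 0 l \<union> ?T 1 l = {s. 0 < s \<and> ereal l < \<bar>h 0 s + h 1 s\<bar>}"
      unfolding sum S_def using \<open>0 \<le> l\<close> by (auto split: if_splits)
    finally show "emeasure lborel {s. 0 < s \<and> ereal l < \<bar>g (s / 2)\<bar>}
      = emeasure lborel {s. 0 < s \<and> ereal l < \<bar>h 0 s + h 1 s\<bar>}" .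
  qed auto
  also have "\<dots> \<le> ennreal C * (R (h 0) + R (h 1))"
    by (intro quasi_triangleD[OF tri] nonneg_measurable_lebesgue_on h_nonneg) auto
  finally show ?thesis using Rh by simp
qed

section \<open>The fundamental function\<close>

text \<open>A zero norm would make the indicator vanish almost everywhere, but the interval has
  measure t > 0. Together with finiteness this makes the quotient \<open>\<sigma>\<close> a positive
  finite number.\<close>

lemma fundamental_function_pos:
  assumes "quasi_banach_function_norm (lebesgue_on {0<..}) R" "0 < t"
  shows "0 < fundamental_function R t"
proof -
  have "\<not> (AE s in lebesgue_on {0<..}. indicator {0<..<t} s = (0::ereal))"
  proof
    assume "AE s in lebesgue_on {0<..}. indicator {0<..<t} s = (0::ereal)"
    then have "AE s in lborel. 0 < s \<longrightarrow> indicator {0<..<t} s = (0::ereal)"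
      by (subst (asm) AE_restrict_space_iff) (auto simp: AE_completion_iff)
    then have "AE s in lborel. s \<notin> {0<..<t}"
      by eventually_elim (auto simp: indicator_def split: if_splits)
    then have "emeasure lborel {0<..<t} = 0"
      by (subst (asm) AE_iff_measurable[of "{0<..<t}"]) auto
    then show False using \<open>0 < t\<close> by simp
  qed
  then have "fundamental_function R t \<noteq> 0"
    unfolding fundamental_function_def
    by (subst quasi_norm_eq_0_iff[OF assms(1)]) (auto intro: nonneg_measurable_lebesgue_on)
  then show ?thesis by (simp add: zero_less_iff_neq_zero)
qed

lemma fundamental_function_finite:
  assumes "quasi_banach_function_norm (lebesgue_on {0<..}) R"
  shows "fundamental_function R t < \<infinity>"
  unfolding fundamental_function_def using assms
proof (rule quasi_norm_indicator_finite)
  show "{0<..<t} \<in> sets (lebesgue_on {0<..})" by (simp add: sets_restrict_space_iff) auto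
  have "emeasure lborel {0<..<t} < \<infinity>" by (cases "0 \<le> t") auto
  then show "emeasure (lebesgue_on {0<..}) {0<..<t} < \<infinity>"
    by (subst emeasure_lebesgue_on_pos) auto
qed

section \<open>The K-functional\<close>

lemma indicator_rearrangement_nonneg: "0 \<le> indicator I s * rearrangement M f u"
  by (simp add: indicator_def rearrangement_nonneg)

section \<open>Upper bound by truncation\<close>

text \<open>Lattice property and homogeneity. It is meant for g = f^* and a at most f^*(t), where
  monotonicity gives a \<le> f^*(s) for s < t.\<close>

lemma mult_fundamental_function_le:
  fixes g :: "real \<Rightarrow> ereal"
  assumes "quasi_banach_function_norm (lebesgue_on {0<..}) R" "0 \<le> a"
    and [measurable]: "g \<in> borel_measurable borel"
    and "\<And>s. 0 \<le> g s" "\<And>s. 0 < s \<Longrightarrow> s < t \<Longrightarrow> ereal a \<le> g s"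
  shows "ennreal a * fundamental_function R t \<le> R (\<lambda>s. indicator {0<..<t} s * g s)"
proof -
  have "ennreal a * fundamental_function R t = R (\<lambda>s. ereal a * indicator {0<..<t} s)"
    unfolding fundamental_function_def
    by (intro quasi_norm_mult[OF assms(1) _ assms(2), symmetric] nonneg_measurable_lebesgue_on) auto
  also have "\<dots> \<le> R (\<lambda>s. indicator {0<..<t} s * g s)"
    using assms
    by (intro quasi_norm_mono[OF assms(1)] nonneg_measurable_lebesgue_on AE_I2)
       (auto simp: indicator_def)
  finally show ?thesis .
qed

text \<open>The quasi-triangle inequality enters once, for the bounded part of \<open>f\<close> in
  the second space. That part produces \<open>C\<close> times both terms on the right, and the
  unbounded part adds the first term once more, whence 1 + C.\<close>

lemma K_functional_upper:
  fixes M :: "'a measure"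
  assumes rep0: "representation_norm M A0 R0" and rep1: "representation_norm M A1 R1"
    and \<sigma>: "\<sigma> = fundamental_function R0 t / fundamental_function R1 t"
    and tri: "quasi_triangle (lebesgue_on {0<..}) R1 C"
    and f [measurable]: "f \<in> borel_measurable M" and t: "0 < t"
  shows "K_functional M A0 A1 f \<sigma> \<le> ennreal (1 + C) *
    (R0 (\<lambda>s. indicator {0<..<t} s * rearrangement M f s)
     + \<sigma> * R1 (\<lambda>s. indicator {t<..} s * rearrangement M f s))"
    (is "_ \<le> _ * (?X + \<sigma> * ?Y)")
proof -
  note C = quasi_triangle_pos[OF tri]
  have q0: "quasi_banach_function_norm (lebesgue_on {0<..}) R0"
    and q1: "quasi_banach_function_norm (lebesgue_on {0<..}) R1"
    using rep0 rep1 by (auto intro: ri_quasi_norm representation_norm_ri)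
  have A0: "A0 h = R0 (rearrangement M h)" and A1: "A1 h = R1 (rearrangement M h)"
    if "h \<in> borel_measurable M" for h
    using rep0 rep1 that by (auto intro: representation_norm_eq)
  define \<phi>0 where "\<phi>0 = fundamental_function R0 t"
  define \<phi>1 where "\<phi>1 = fundamental_function R1 t"
  have \<phi>: "0 < \<phi>0" "0 < \<phi>1" "\<phi>0 < \<infinity>" "\<phi>1 < \<infinity>"
    unfolding \<phi>0_def \<phi>1_def
    using fundamental_function_pos[OF _ t] fundamental_function_finite q0 q1 by blast+
  have \<sigma>0: "\<sigma> \<noteq> 0" "\<sigma> < \<infinity>" and \<sigma>\<phi>: "\<sigma> * \<phi>1 = \<phi>0"
  proof -
    show "\<sigma> \<noteq> 0" "\<sigma> < \<infinity>" using \<phi> unfolding \<sigma> \<phi>0_def[symmetric] \<phi>1_def[symmetric]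
      by (auto simp: less_top[symmetric] ennreal_divide_eq_top_iff)
    show "\<sigma> * \<phi>1 = \<phi>0"
      using \<phi> unfolding \<sigma> \<phi>0_def[symmetric] \<phi>1_def[symmetric]
      by (simp add: ennreal_divide_times)
  qed
  show ?thesis
  \<comment> \<open>If a norm on the right is infinite, so is the whole right-hand side, since
    \<open>\<sigma>\<close> and 1 + C are nonzero. Otherwise finiteness makes the truncation an
    admissible decomposition.\<close>
  proof (cases "?X = \<infinity> \<or> ?Y = \<infinity>")
    case True
    then have "ennreal (1 + C) * (?X + \<sigma> * ?Y) = \<infinity>"
      using \<sigma>0 C by (auto simp: ennreal_mult_eq_top_iff)
    then show ?thesis by simp
  next
    case False
    \<comment> \<open>Used twice: with large \<open>b\<close> to show that f^*(t) is finite, and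
      with b = f^*(t) to absorb the contribution of the truncation level.\<close>
    have level: "ennreal b * \<phi>0 \<le> ?X" if "0 \<le> b" "ereal b \<le> rearrangement M f t" for b
      unfolding \<phi>0_def using that rearrangement_antimono[of _ t M f]
      by (intro mult_fundamental_function_le q0) (auto intro: rearrangement_nonneg order_trans)
    have "rearrangement M f t \<noteq> \<infinity>"
    proof
      assume inf: "rearrangement M f t = \<infinity>"
      obtain p where p: "\<phi>0 = ennreal p" "0 < p" using \<phi> by (cases \<phi>0) auto
      obtain x where x: "?X = ennreal x" "0 \<le> x" using False by (cases ?X) auto
      \<comment> \<open>The level (x + 1)/p is chosen so that its product with
        \<open>\<phi>0\<close> is x + 1, which exceeds \<open>?X\<close>.\<close>
      have "ennreal ((x + 1) / p) * \<phi>0 \<le> ?X" using inf p x by (intro level) auto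
      then have "ennreal (x + 1) \<le> ennreal x"
        using p x by (simp add: ennreal_mult[symmetric])
      then show False using x by simp
    qed
    then obtain a where a: "rearrangement M f t = ereal a"
      using rearrangement_nonneg[of M f t] by (cases "rearrangement M f t") auto
    then have "0 \<le> a" using rearrangement_nonneg[of M f t] by simp
    \<comment> \<open>\<open>f0\<close> is the signed excess of \<open>f\<close> over the level
      \<open>a\<close>, and \<open>f1\<close> is \<open>f\<close> clipped to [-a, a]. As
      \<open>f1\<close> is finite, f = f0 + f1 holds at every point, even where \<open>f\<close> is
      infinite.\<close>
    define f0 where
      "f0 x = (if ereal a < f x then f x - ereal a else if f x < - ereal a then f x + ereal a else 0)" for x
    define f1 where "f1 x = max (- ereal a) (min (ereal a) (f x))" for x
    have [measurable]: "f0 \<in> borel_measurable M" "f1 \<in> borel_measurable M"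
      unfolding f0_def f1_def by measurable
    have split: "f x = f0 x + f1 x" for x
      unfolding f0_def f1_def using \<open>0 \<le> a\<close> by (cases "f x") (auto simp: max_def min_def)
    have "\<bar>f0 x\<bar> \<le> \<bar>f x\<bar>" for x
      unfolding f0_def using \<open>0 \<le> a\<close> by (cases "f x") auto
    then have f0_le: "rearrangement M f0 s \<le> rearrangement M f s" for s
      by (intro rearrangement_mono) auto
    have "\<bar>f1 x\<bar> \<le> \<bar>f x\<bar>" for x
      unfolding f1_def using \<open>0 \<le> a\<close> by (cases "f x") (auto simp: max_def min_def)
    then have f1_le: "rearrangement M f1 s \<le> rearrangement M f s" for s
      by (intro rearrangement_mono) auto
    have "\<bar>f1 x\<bar> \<le> ereal a" for x
      unfolding f1_def using \<open>0 \<le> a\<close> by (cases "f x") (auto simp: max_def min_def)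
    then have f1_le_a: "rearrangement M f1 s \<le> ereal a" for s
      using \<open>0 \<le> a\<close> by (intro rearrangement_le) (simp_all add: not_less[symmetric])
    \<comment> \<open>\<open>f0\<close> is nonzero only where |f| > a, a set of measure at most
      \<open>t\<close> because the infimum is attained at \<open>a\<close>. Thus level 0 qualifies
      for every s \<ge> t.\<close>
    have f0_tail: "rearrangement M f0 s \<le> 0" if "t \<le> s" for s
    proof -
      have "{x \<in> space M. ereal 0 < \<bar>f0 x\<bar>} \<subseteq> {x \<in> space M. ereal a < \<bar>f x\<bar>}"
      proof clarify
        fix x assume "ereal 0 < \<bar>f0 x\<bar>"
        then show "ereal a < \<bar>f x\<bar>"
          unfolding f0_def using \<open>0 \<le> a\<close> by (cases "f x") (auto split: if_splits)
      qed
      then have "emeasure M {x \<in> space M. ereal 0 < \<bar>f0 x\<bar>} \<le> emeasure M {x \<in> space M. ereal a < \<bar>f x\<bar>}"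
        by (intro emeasure_mono) auto
      also have "\<dots> \<le> ennreal s"
        using emeasure_above_rearrangement[OF f a] that by (auto intro: order_trans ennreal_leI)
      finally show ?thesis using rearrangement_le[of 0] by (simp add: zero_ereal_def)
    qed
    have "A0 f0 \<le> ?X"
    proof -
      have "rearrangement M f0 s \<le> indicator {0<..<t} s * rearrangement M f s" if "0 < s" for s
        using f0_le f0_tail that by (cases "s < t") auto
      then show ?thesis
        unfolding A0[OF \<open>f0 \<in> borel_measurable M\<close>]
        by (intro quasi_norm_mono[OF q0] nonneg_measurable_lebesgue_on AE_I2)
           (auto intro!: rearrangement_nonneg indicator_rearrangement_nonneg)
    qed
    moreover have A1f1: "A1 f1 \<le> ennreal C * (ennreal a * \<phi>1 + ?Y)"
    proof -
      let ?u = "\<lambda>s. ereal a * indicator {0<..<t} s :: ereal"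
      let ?v = "\<lambda>s. indicator {t<..} s * rearrangement M f s"
      \<comment> \<open>Both open intervals miss \<open>t\<close>, where the pointwise bound below
        may fail; a single point is null.\<close>
      have "AE s in lebesgue_on {0<..}. s \<noteq> t"
        by (subst AE_restrict_space_iff) (auto intro!: AE_completion eventually_mono[OF AE_lborel_singleton[of t]])
      then have "AE s in lebesgue_on {0<..}. rearrangement M f1 s \<le> ?u s + ?v s"
        using AE_space
      proof eventually_elim
        case (elim s)
        then show ?case using f1_le[of s] f1_le_a[of s] by (cases s t rule: linorder_cases) auto
      qed
      then have "A1 f1 \<le> R1 (\<lambda>s. ?u s + ?v s)"
        unfolding A1[OF \<open>f1 \<in> borel_measurable M\<close>] using \<open>0 \<le> a\<close>
        by (intro quasi_norm_mono[OF q1] nonneg_measurable_lebesgue_on)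
           (auto intro!: rearrangement_nonneg indicator_rearrangement_nonneg add_nonneg_nonneg)
      also have "\<dots> \<le> ennreal C * (R1 ?u + R1 ?v)"
        using \<open>0 \<le> a\<close> by (intro quasi_triangleD[OF tri] nonneg_measurable_lebesgue_on)
           (auto intro!: rearrangement_nonneg indicator_rearrangement_nonneg)
      also have "R1 ?u = ennreal a * \<phi>1"
        unfolding \<phi>1_def fundamental_function_def
        by (intro quasi_norm_mult[OF q1 _ \<open>0 \<le> a\<close>] nonneg_measurable_lebesgue_on) auto
      finally show ?thesis .
    qed
    moreover have "ennreal C * (ennreal a * \<phi>1 + ?Y) < \<infinity>"
      using False \<phi> by (auto simp: ennreal_mult_eq_top_iff less_top[symmetric])
    ultimately have "(f0, f1) \<in> decompositions M A0 A1 f"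
      unfolding decompositions_def function_space_def using False split
      by (auto simp: less_top[symmetric] top_unique)
    then have "K_functional M A0 A1 f \<sigma> \<le> A0 f0 + \<sigma> * A1 f1"
      unfolding K_functional_def by (rule INF_lower2) auto
    also have "\<dots> \<le> ?X + \<sigma> * (ennreal C * (ennreal a * \<phi>1 + ?Y))"
      by (intro add_mono mult_left_mono \<open>A0 f0 \<le> ?X\<close> A1f1) auto
    also have "\<dots> = ?X + ennreal C * (ennreal a * (\<sigma> * \<phi>1)) + ennreal C * (\<sigma> * ?Y)"
      by (simp add: algebra_simps)
    \<comment> \<open>Here \<sigma> \<phi>1 = \<phi>0 turns the level term of the second norm into
      one of the first, and \<open>level\<close> with b = a bounds it by \<open>?X\<close>.\<close>
    also have "\<dots> \<le> ?X + ennreal C * ?X + ennreal (1 + C) * (\<sigma> * ?Y)"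
      unfolding \<sigma>\<phi> using level[OF \<open>0 \<le> a\<close>] a
      by (intro add_mono mult_left_mono mult_right_mono order_refl ennreal_leI) auto
    also have "\<dots> = ennreal (1 + C) * (?X + \<sigma> * ?Y)"
      using C by (simp add: algebra_simps ennreal_plus)
    finally show ?thesis .
  qed
qed

section \<open>Lower bound for an arbitrary decomposition\<close>

lemma cut_rearrangement_add_le:
  assumes q: "quasi_banach_function_norm (lebesgue_on {0<..}) R"
    and tri: "quasi_triangle (lebesgue_on {0<..}) R C"
    and [measurable]: "I \<in> sets borel"
    and f: "f \<in> borel_measurable M" "f0 \<in> borel_measurable M" "f1 \<in> borel_measurable M"
    and sum: "AE x in M. f x = f0 x + f1 x"
  shows "R (\<lambda>s. indicator I s * rearrangement M f s)
      \<le> ennreal C * (R (\<lambda>s. indicator I s * rearrangement M f0 (s / 2))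
                   + R (\<lambda>s. indicator I s * rearrangement M f1 (s / 2)))"
proof -
  have "indicator I s * rearrangement M f s
    \<le> indicator I s * rearrangement M f0 (s / 2) + indicator I s * rearrangement M f1 (s / 2)"
    if "0 < s" for s
    using rearrangement_add_le[OF f sum that] by (simp add: indicator_def)
  then have "R (\<lambda>s. indicator I s * rearrangement M f s) \<le>
    R (\<lambda>s. indicator I s * rearrangement M f0 (s / 2) + indicator I s * rearrangement M f1 (s / 2))"
    by (intro quasi_norm_mono[OF q] nonneg_measurable_lebesgue_on AE_I2)
       (auto intro!: indicator_rearrangement_nonneg add_nonneg_nonneg)
  also have "\<dots> \<le> ennreal C * (R (\<lambda>s. indicator I s * rearrangement M f0 (s / 2))
                 + R (\<lambda>s. indicator I s * rearrangement M f1 (s / 2)))"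
    by (intro quasi_triangleD[OF tri] nonneg_measurable_lebesgue_on)
       (auto intro!: indicator_rearrangement_nonneg)
  finally show ?thesis .
qed

text \<open>Drop the indicator by the lattice property, then apply the dilation bound. This serves
  the diagonal terms, in which the part of \<open>f\<close> from each space is measured in its own
  norm.\<close>

lemma cut_dilation_bounded:
  assumes ri: "ri_quasi_banach_function_norm (lebesgue_on {0<..}) R"
    and tri: "quasi_triangle (lebesgue_on {0<..}) R C" and [measurable]: "I \<in> sets borel"
  shows "R (\<lambda>s. indicator I s * rearrangement M h (s / 2)) \<le> ennreal (2 * C) * R (rearrangement M h)"
proof -
  have "R (\<lambda>s. indicator I s * rearrangement M h (s / 2)) \<le> R (\<lambda>s. rearrangement M h (s / 2))"
    by (intro quasi_norm_mono[OF ri_quasi_norm[OF ri]] nonneg_measurable_lebesgue_on AE_I2)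
       (auto simp: indicator_def rearrangement_nonneg)
  also have "\<dots> \<le> ennreal C * (R (rearrangement M h) + R (rearrangement M h))"
    by (intro dilation_bounded[OF ri _ _ tri]) (auto intro: rearrangement_nonneg)
  also have "\<dots> = ennreal (2 * C) * R (rearrangement M h)"
    using quasi_triangle_pos[OF tri] by (simp add: ennreal_mult mult_2[symmetric] mult_ac)
  finally show ?thesis .
qed

text \<open>Here \<open>t\<close> and \<open>\<sigma>\<close> are fixed, and the resulting constant
  involves neither. In each of its two summands, the factor C_i comes from splitting the norm, 2 C_i
  from the diagonal term and c_i from the mixed one.\<close>

lemma K_functional_lower:
  fixes M :: "'a measure"
  assumes rep0: "representation_norm M A0 R0" and rep1: "representation_norm M A1 R1"
    and tri0: "quasi_triangle (lebesgue_on {0<..}) R0 C0"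
    and tri1: "quasi_triangle (lebesgue_on {0<..}) R1 C1"
    and c0: "0 < c0" and bd0: "\<And>g. g \<in> function_space M A1 \<Longrightarrow>
       R0 (\<lambda>s. indicator {0<..<t} s * rearrangement M g (s / 2)) \<le> ennreal c0 * (\<sigma> * R1 (rearrangement M g))"
    and c1: "0 < c1" and bd1: "\<And>h. h \<in> function_space M A0 \<Longrightarrow>
       \<sigma> * R1 (\<lambda>s. indicator {t<..} s * rearrangement M h (s / 2)) \<le> ennreal c1 * R0 (rearrangement M h)"
    and f [measurable]: "f \<in> borel_measurable M"
  shows "R0 (\<lambda>s. indicator {0<..<t} s * rearrangement M f s)
     + \<sigma> * R1 (\<lambda>s. indicator {t<..} s * rearrangement M f s)
    \<le> ennreal (C0 * (2 * C0 + c0) + C1 * (2 * C1 + c1)) * K_functional M A0 A1 f \<sigma>"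
    (is "?L \<le> ennreal ?c * _")
proof -
  have ri0: "ri_quasi_banach_function_norm (lebesgue_on {0<..}) R0"
    and ri1: "ri_quasi_banach_function_norm (lebesgue_on {0<..}) R1"
    using rep0 rep1 by (auto intro: representation_norm_ri)
  then have q0: "quasi_banach_function_norm (lebesgue_on {0<..}) R0"
    and q1: "quasi_banach_function_norm (lebesgue_on {0<..}) R1"
    by (auto intro: ri_quasi_norm)
  note C0 = quasi_triangle_pos[OF tri0] and C1 = quasi_triangle_pos[OF tri1]
  have "0 < ?c" using C0 C1 c0 c1 by (intro add_pos_pos mult_pos_pos) auto
  have bound: "?L \<le> ennreal ?c * (A0 f0 + \<sigma> * A1 f1)"
    if d: "(f0, f1) \<in> decompositions M A0 A1 f" for f0 f1
  proof -
    have f0: "f0 \<in> function_space M A0" "f0 \<in> borel_measurable M"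
      and f1: "f1 \<in> function_space M A1" "f1 \<in> borel_measurable M"
      and sum: "AE x in M. f x = f0 x + f1 x"
      using d unfolding decompositions_def function_space_def by auto
    define x where "x = A0 f0"
    define y where "y = \<sigma> * A1 f1"
    have x: "R0 (rearrangement M f0) = x" and y: "\<sigma> * R1 (rearrangement M f1) = y"
      unfolding x_def y_def
      using representation_norm_eq[OF rep0 f0(2)] representation_norm_eq[OF rep1 f1(2)] by simp_all
    have "R0 (\<lambda>s. indicator {0<..<t} s * rearrangement M f s)
      \<le> ennreal C0 * (R0 (\<lambda>s. indicator {0<..<t} s * rearrangement M f0 (s / 2))
                   + R0 (\<lambda>s. indicator {0<..<t} s * rearrangement M f1 (s / 2)))"
      by (rule cut_rearrangement_add_le[OF q0 tri0 _ f f0(2) f1(2) sum]) auto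
    \<comment> \<open>The \<open>f0\<close> term is diagonal and is handled by dilation; the
      \<open>f1\<close> term is mixed and is handled by the first hypothesis.\<close>
    also have "\<dots> \<le> ennreal C0 * (ennreal (2 * C0) * x + ennreal c0 * y)"
      using cut_dilation_bounded[OF ri0 tri0, of "{0<..<t}" M f0] bd0[OF f1(1)] unfolding x y
      by (intro mult_left_mono add_mono) auto
    \<comment> \<open>Both coefficients are raised to a common value so that x + y factors
      out.\<close>
    also have "\<dots> \<le> ennreal C0 * (ennreal (2 * C0 + c0) * x + ennreal (2 * C0 + c0) * y)"
      using C0 c0 by (intro mult_left_mono add_mono mult_right_mono ennreal_leI) auto
    also have "\<dots> = ennreal (C0 * (2 * C0 + c0)) * (x + y)"
      using C0 c0 by (subst ennreal_mult) (simp_all add: distrib_left mult.assoc del: ennreal_plus)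
    finally have 1: "R0 (\<lambda>s. indicator {0<..<t} s * rearrangement M f s)
      \<le> ennreal (C0 * (2 * C0 + c0)) * (x + y)" .
    have "\<sigma> * R1 (\<lambda>s. indicator {t<..} s * rearrangement M f s)
      \<le> \<sigma> * (ennreal C1 * (R1 (\<lambda>s. indicator {t<..} s * rearrangement M f0 (s / 2))
                   + R1 (\<lambda>s. indicator {t<..} s * rearrangement M f1 (s / 2))))"
      by (intro mult_left_mono cut_rearrangement_add_le[OF q1 tri1 _ f f0(2) f1(2) sum]) auto
    also have "\<dots> = ennreal C1 * (\<sigma> * R1 (\<lambda>s. indicator {t<..} s * rearrangement M f0 (s / 2))
                   + \<sigma> * R1 (\<lambda>s. indicator {t<..} s * rearrangement M f1 (s / 2)))"
      by (simp add: distrib_left mult_ac)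
    \<comment> \<open>The roles are exchanged: \<open>f0\<close> is now the mixed term, controlled
      by the second hypothesis, and \<open>f1\<close> the diagonal one.\<close>
    also have "\<dots> \<le> ennreal C1 * (ennreal c1 * x + \<sigma> * (ennreal (2 * C1) * R1 (rearrangement M f1)))"
      using cut_dilation_bounded[OF ri1 tri1, of "{t<..}" M f1] bd1[OF f0(1)] unfolding x
      by (intro mult_left_mono add_mono) auto
    also have "\<dots> = ennreal C1 * (ennreal c1 * x + ennreal (2 * C1) * y)"
      unfolding y[symmetric] by (simp add: mult_ac)
    also have "\<dots> \<le> ennreal C1 * (ennreal (2 * C1 + c1) * x + ennreal (2 * C1 + c1) * y)"
      using C1 c1 by (intro mult_left_mono add_mono mult_right_mono ennreal_leI) auto
    also have "\<dots> = ennreal (C1 * (2 * C1 + c1)) * (x + y)"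
      using C1 c1 by (subst ennreal_mult) (simp_all add: distrib_left mult.assoc del: ennreal_plus)
    finally have 2: "\<sigma> * R1 (\<lambda>s. indicator {t<..} s * rearrangement M f s)
      \<le> ennreal (C1 * (2 * C1 + c1)) * (x + y)" .
    have "ennreal ?c = ennreal (C0 * (2 * C0 + c0)) + ennreal (C1 * (2 * C1 + c1))"
      using C0 C1 c0 c1 by (intro ennreal_plus) auto
    then show ?thesis
      unfolding x_def[symmetric] y_def[symmetric] using add_mono[OF 1 2] by (simp add: distrib_right)
  qed
  \<comment> \<open>Dividing by the constant first gives a lower bound common to all decompositions,
    which passes to the infimum; the constant, positive and finite, is then multiplied back.\<close>
  have "?L / ennreal ?c \<le> K_functional M A0 A1 f \<sigma>"
    unfolding K_functional_def
  proof (rule INF_greatest, clarify)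
    fix f0 f1 assume "(f0, f1) \<in> decompositions M A0 A1 f"
    then show "?L / ennreal ?c \<le> A0 f0 + \<sigma> * A1 f1"
      using \<open>0 < ?c\<close> by (intro divide_le_posI_ennreal bound) auto
  qed
  then have "ennreal ?c * (?L / ennreal ?c) \<le> ennreal ?c * K_functional M A0 A1 f \<sigma>"
    by (rule mult_left_mono) simp
  moreover have "ennreal ?c * (?L / ennreal ?c) = ?L"
    using \<open>0 < ?c\<close> mult_divide_eq_ennreal[of "ennreal ?c" ?L]
    by (simp add: ennreal_times_divide mult.commute)
  ultimately show ?thesis by simp
qed

section \<open>The two-sided estimate with uniform constants\<close>

theorem theorem1p3:
  fixes M :: "'a measure"
    and A0 A1 :: "('a \<Rightarrow> ereal) \<Rightarrow> ennreal"
    and R0 R1 :: "(real \<Rightarrow> ereal) \<Rightarrow> ennreal"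
    and \<sigma> :: "real \<Rightarrow> ennreal"
  assumes "sigma_finite_measure M" and "nonatomic M" and "0 < emeasure M (space M)"
    and "ri_quasi_banach_function_norm M A0" and "ri_quasi_banach_function_norm M A1"
    and "representation_norm M A0 R0" and "representation_norm M A1 R1"
    and "\<And>t. 0 < t \<Longrightarrow> \<sigma> t = fundamental_function R0 t / fundamental_function R1 t"
    and "\<exists>c::real. 0 < c \<and> (\<forall>t>0. \<forall>g\<in>function_space M A1.
           R0 (\<lambda>s. indicator {0<..<t} s * rearrangement M g (s / 2))
             \<le> ennreal c * (\<sigma> t * R1 (rearrangement M g)))"
    and "\<exists>c::real. 0 < c \<and> (\<forall>t>0. \<forall>h\<in>function_space M A0.
           \<sigma> t * R1 (\<lambda>s. indicator {t<..} s * rearrangement M h (s / 2))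
             \<le> ennreal c * R0 (rearrangement M h))"
  shows "\<exists>c C :: real. 0 < c \<and> 0 < C \<and> (\<forall>f\<in>sum_space M A0 A1. \<forall>t>0.
           K_functional M A0 A1 f (\<sigma> t)
             \<le> ennreal C * (R0 (\<lambda>s. indicator {0<..<t} s * rearrangement M f s)
                 + \<sigma> t * R1 (\<lambda>s. indicator {t<..} s * rearrangement M f s)) \<and>
           R0 (\<lambda>s. indicator {0<..<t} s * rearrangement M f s)
                 + \<sigma> t * R1 (\<lambda>s. indicator {t<..} s * rearrangement M f s)
             \<le> ennreal c * K_functional M A0 A1 f (\<sigma> t))"
proof -
  note rep = assms(6,7)
  have q0: "quasi_banach_function_norm (lebesgue_on {0<..}) R0"
    and q1: "quasi_banach_function_norm (lebesgue_on {0<..}) R1"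
    using rep by (auto intro: ri_quasi_norm representation_norm_ri)
  \<comment> \<open>All four constants are fixed before \<open>f\<close> and \<open>t\<close> are
    introduced, which gives the required uniformity.\<close>
  obtain C0 where C0: "quasi_triangle (lebesgue_on {0<..}) R0 C0"
    by (rule quasi_norm_triangle[OF q0])
  obtain C1 where C1: "quasi_triangle (lebesgue_on {0<..}) R1 C1"
    by (rule quasi_norm_triangle[OF q1])
  obtain c0 where c0: "0 < c0" "\<And>t g. 0 < t \<Longrightarrow> g \<in> function_space M A1 \<Longrightarrow>
      R0 (\<lambda>s. indicator {0<..<t} s * rearrangement M g (s / 2))
        \<le> ennreal c0 * (\<sigma> t * R1 (rearrangement M g))"
    using assms(9) by blast
  obtain c1 where c1: "0 < c1" "\<And>t h. 0 < t \<Longrightarrow> h \<in> function_space M A0 \<Longrightarrow>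
      \<sigma> t * R1 (\<lambda>s. indicator {t<..} s * rearrangement M h (s / 2))
        \<le> ennreal c1 * R0 (rearrangement M h)"
    using assms(10) by blast
  show ?thesis
  proof (intro exI conjI ballI allI impI)
    show "0 < C0 * (2 * C0 + c0) + C1 * (2 * C1 + c1)" "0 < 1 + C1"
      using quasi_triangle_pos[OF C0] quasi_triangle_pos[OF C1] c0(1) c1(1)
      by (auto intro!: add_pos_pos mult_pos_pos)
    fix f t assume "f \<in> sum_space M A0 A1" and t: "0 < (t::real)"
    then have f: "f \<in> borel_measurable M" unfolding sum_space_def by simp
    show "K_functional M A0 A1 f (\<sigma> t)
      \<le> ennreal (1 + C1) * (R0 (\<lambda>s. indicator {0<..<t} s * rearrangement M f s)
          + \<sigma> t * R1 (\<lambda>s. indicator {t<..} s * rearrangement M f s))"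
      by (rule K_functional_upper[OF rep assms(8)[OF t] C1 f t])
    show "R0 (\<lambda>s. indicator {0<..<t} s * rearrangement M f s)
          + \<sigma> t * R1 (\<lambda>s. indicator {t<..} s * rearrangement M f s)
      \<le> ennreal (C0 * (2 * C0 + c0) + C1 * (2 * C1 + c1)) * K_functional M A0 A1 f (\<sigma> t)"
      by (rule K_functional_lower[OF rep C0 C1 c0(1) c0(2)[OF t] c1(1) c1(2)[OF t] f])
  qed
qed

end
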